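(* Let $q\in\mathbb{C}$ with $|q|<1$. Define $$\Gamma_1 := \frac{f(q, q^{9})}{f(-q, -q^{9})}, \qquad \Gamma_2 := \frac{f(q^3, q^{7})}{f(-q^3, -q^{7})}.$$ Then $$\Gamma_1^2+\Gamma_2^2 = \frac{\varphi^4(q)}{4\varphi^4(-q^{10})} + \frac{\varphi^4(q^5)}{4\varphi^4(-q^{10})} - \frac{\varphi^2(q)\varphi^2(q^5)}{2\varphi^4(-q^{10})} + \frac{2\psi(q)\psi(-q^5)}{\psi(-q)\psi(q^5)}.$$
   Context: For $|rs|<1$, Ramanujan's general theta function is $f(r,s)=\sum_{n=-\infty}^{\infty} r^{n(n+1)/2}s^{n(n-1)/2}$. Also $\varphi(q)=f(q,q)=\sum_{n=-\infty}^{\infty}q^{n^2}$ and $\psi(q)=f(q,q^3)=\sum_{n\ge0}q^{n(n+1)/2}$. *)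

theory Defs
  imports "HOL-Analysis.Analysis"
begin

text \<open>
  The products \<open>n * (n + 1)\<close> and \<open>n * (n - 1)\<close> are even and nonnegative for every integer \<open>n\<close>,
  so neither \<open>div\<close> nor \<open>nat\<close> loses information. The bilateral series is absolutely
  convergent for \<open>norm (r * s) < 1\<close>; outside that range the value has no significance.
\<close>

definition theta_f :: "complex \<Rightarrow> complex \<Rightarrow> complex" where
  "theta_f r s = (\<Sum>\<^sub>\<infinity>n\<in>(UNIV :: int set). r ^ nat (n * (n + 1) div 2) * s ^ nat (n * (n - 1) div 2))"

definition theta_phi :: "complex \<Rightarrow> complex" where
  "theta_phi q = theta_f q q"

definition theta_psi :: "complex \<Rightarrow> complex" where
  "theta_psi q = theta_f q (q ^ 3)"

definition Gamma1 :: "complex \<Rightarrow> complex" where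
  "Gamma1 q = theta_f q (q ^ 9) / theta_f (- q) (- (q ^ 9))"

definition Gamma2 :: "complex \<Rightarrow> complex" where
  "Gamma2 q = theta_f (q ^ 3) (q ^ 7) / theta_f (- (q ^ 3)) (- (q ^ 7))"

end

theory Submission
  imports Defs "HOL-Complex_Analysis.Conformal_Mappings"
begin

text \<open>
  Write \<open>D(q) = f(q, q\<^sup>9) f(q\<^sup>3, q\<^sup>7)\<close>. The theorem is the identity
  \<open>\<Gamma>\<^sub>1\<^sup>2 + \<Gamma>\<^sub>2\<^sup>2 = (\<Gamma>\<^sub>1 - \<Gamma>\<^sub>2)\<^sup>2 + 2 \<Gamma>\<^sub>1 \<Gamma>\<^sub>2\<close> combined with
  \<open>\<Gamma>\<^sub>1 - \<Gamma>\<^sub>2 = (\<phi>\<^sup>2(q) - \<phi>\<^sup>2(q\<^sup>5)) / (2 \<phi>\<^sup>2(-q\<^sup>1\<^sup>0))\<close> and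
  \<open>\<Gamma>\<^sub>1 \<Gamma>\<^sub>2 = D(q) / D(-q) = \<psi>(q) \<psi>(-q\<^sup>5) / (\<psi>(-q) \<psi>(q\<^sup>5))\<close>.

  The first formula follows from splitting products of two theta series over the cosets of a
  sublattice of \<open>\<int>\<^sup>2\<close>: index 2 gives \<open>f(r, s) f(-r, -s) = f(-r\<^sup>2, -s\<^sup>2) \<phi>(-rs)\<close> and similar
  identities, and index 5, the ideal of \<open>2 + \<i>\<close> in the Gaussian integers, gives
  \<open>\<phi>\<^sup>2(q) - \<phi>\<^sup>2(q\<^sup>5) = 4 q D(q)\<close>. Together these give
  \<open>(m\<^sup>2 - 1) (k\<^sup>2 - 1) = 4 (m k - 1)\<close> for \<open>m = \<phi>(q) / \<phi>(q\<^sup>5)\<close> and \<open>k = \<phi>(-q) / \<phi>(-q\<^sup>5)\<close>.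
  Comparing this relation at \<open>q\<close> and at \<open>q\<^sup>2\<close> yields the second formula, up to the choice of a
  root of a quadratic equation. The root is identified for small \<open>q\<close>, and analytic continuation
  extends the result to the unit disc.
\<close>

section \<open>Convergence, bounds and holomorphy of the theta series\<close>

text \<open>The majorant for all theta series. Leaving out \<open>0\<close> makes its value a bound
  for the distance of a theta series from its term \<open>1\<close> at \<open>n = 0\<close>.\<close>

lemma has_sum_geometric_int:
  fixes t :: real
  assumes "0 \<le> t" "t < 1"
  shows "((\<lambda>n::int. t ^ nat \<bar>n\<bar>) has_sum 2 * t / (1 - t)) (UNIV - {0})"
proof -
  have "((\<lambda>n. t ^ Suc n) has_sum t / (1 - t)) UNIV"
    using assms geometric_sums[of t] sums_mult[of "\<lambda>n. t ^ n" "1 / (1 - t)" t]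
    by (intro sums_nonneg_imp_has_sum) auto
  moreover have "((\<lambda>n. t ^ nat \<bar>n\<bar>) has_sum S) {1..} \<longleftrightarrow> ((\<lambda>n. t ^ Suc n) has_sum S) UNIV"
    "((\<lambda>n. t ^ nat \<bar>n\<bar>) has_sum S) {..-1} \<longleftrightarrow> ((\<lambda>n. t ^ Suc n) has_sum S) UNIV" for S
    subgoal
      by (rule has_sum_reindex_bij_witness[of _ "\<lambda>n. int (Suc n)" "\<lambda>n. nat (n - 1)"])
         (auto simp: Suc_nat_eq_nat_zadd1 simp flip: power_Suc)
    subgoal
      by (rule has_sum_reindex_bij_witness[of _ "\<lambda>n. - int (Suc n)" "\<lambda>n. nat (- n - 1)"])
         (auto simp: Suc_nat_eq_nat_zadd1 simp flip: power_Suc)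
    done
  ultimately have "((\<lambda>n::int. t ^ nat \<bar>n\<bar>) has_sum (t / (1 - t) + t / (1 - t))) ({1..} \<union> {..-1})"
    by (intro has_sum_Un_disjoint) auto
  moreover have "{1..} \<union> {..-1} = (UNIV - {0} :: int set)"
    by auto
  ultimately show ?thesis
    by simp
qed

lemma summable_on_geometric_int:
  fixes t :: real
  assumes "0 \<le> t" "t < 1"
  shows "(\<lambda>n::int. t ^ nat \<bar>n\<bar>) summable_on UNIV"
proof -
  have "(\<lambda>n::int. t ^ nat \<bar>n\<bar>) summable_on (UNIV - {0}) \<union> {0}"
    using has_sum_imp_summable[OF has_sum_geometric_int[OF assms]]
    by (intro summable_on_Un_disjoint) auto
  then show ?thesis
    by simp
qed

text \<open>The two exponents add up to \<open>n * n\<close>, which is at least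
  \<open>\<bar>n\<bar>\<close>.\<close>

lemma norm_theta_f_term_le:
  fixes r s :: complex and n :: int
  assumes "norm r \<le> t" "norm s \<le> t" "t < 1"
  shows "norm (r ^ nat (n * (n + 1) div 2) * s ^ nat (n * (n - 1) div 2)) \<le> t ^ nat \<bar>n\<bar>"
proof -
  have t: "0 \<le> t"
    using assms norm_ge_zero[of r] by linarith
  have nn: "0 \<le> n * (n + 1)" "0 \<le> n * (n - 1)"
    by (cases "n \<ge> 0"; cases "n \<ge> 1"; auto simp: zero_le_mult_iff)+
  have ev: "n * (n + 1) div 2 + n * (n - 1) div 2 = n * n"
    by (cases "even n") (auto elim!: evenE oddE simp: algebra_simps)
  have "norm (r ^ nat (n * (n + 1) div 2) * s ^ nat (n * (n - 1) div 2))
      \<le> t ^ nat (n * (n + 1) div 2) * t ^ nat (n * (n - 1) div 2)"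
    unfolding norm_mult norm_power using assms t by (intro mult_mono power_mono) auto
  also have "\<dots> = t ^ nat (n * n)"
    using nn ev by (simp flip: power_add nat_add_distrib)
  also have "\<dots> \<le> t ^ nat \<bar>n\<bar>"
  proof (rule power_decreasing)
    have "\<bar>n\<bar> * 1 \<le> \<bar>n\<bar> * \<bar>n\<bar>" if "n \<noteq> 0"
      using that by (intro mult_left_mono) auto
    then show "nat \<bar>n\<bar> \<le> nat (n * n)"
      by (cases "n = 0") auto
  qed (use assms t in auto)
  finally show ?thesis .
qed

lemma norm_theta_f_minus_one_le:
  assumes "norm r \<le> t" "norm s \<le> t" "t < 1"
  shows "norm (theta_f r s - 1) \<le> 2 * t / (1 - t)"
proof -
  define h where "h = (\<lambda>n::int. r ^ nat (n * (n + 1) div 2) * s ^ nat (n * (n - 1) div 2))"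
  have t: "0 \<le> t"
    using assms norm_ge_zero[of r] by linarith
  have "(\<lambda>n. norm (h n)) summable_on UNIV"
    using norm_theta_f_term_le[OF assms]
    by (intro Infinite_Sum.abs_summable_on_comparison_test'[OF summable_on_geometric_int[OF t assms(3)]])
       (auto simp: h_def)
  then have sm: "h summable_on UNIV"
    by (rule abs_summable_summable)
  then have "h summable_on (UNIV - {0})"
    by (rule summable_on_subset_banach) auto
  then have hs: "(h has_sum infsum h (UNIV - {0})) (UNIV - {0})"
    by simp
  have "infsum h ((UNIV - {0}) \<union> {0}) = infsum h (UNIV - {0}) + infsum h {0}"
    by (rule infsum_Un_disjoint) (use \<open>h summable_on (UNIV - {0})\<close> in auto)
  then have "theta_f r s - 1 = infsum h (UNIV - {0})"
    by (simp add: theta_f_def h_def)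
  then show ?thesis
    using norm_infsum_le[OF hs has_sum_geometric_int[OF t assms(3)]]
      norm_theta_f_term_le[OF assms] by (simp add: h_def)
qed

lemma theta_phi_holomorphic: "theta_phi holomorphic_on ball 0 1"
proof -
  \<comment> \<open>The majorant is uniform only on closed discs of radius \<open>r < 1\<close>, so
    these are treated first.\<close>
  have *: "theta_phi holomorphic_on ball 0 r" if "0 < r" "r < 1" for r :: real
  proof (rule holomorphic_uniform_limit[where z = "0::complex" and r = r and g = theta_phi])
    let ?h = "\<lambda>(n::int) q::complex. q ^ nat (n * (n + 1) div 2) * q ^ nat (n * (n - 1) div 2)"
    have "uniform_limit (cball 0 r) (\<lambda>X q. \<Sum>n\<in>X. ?h n q) (\<lambda>q. \<Sum>\<^sub>\<infinity>n\<in>UNIV. ?h n q)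
        (finite_subsets_at_top UNIV)"
      using that
      by (intro Weierstrass_m_test_general[OF _ summable_on_geometric_int[of r]]
          norm_theta_f_term_le) auto
    then show "uniform_limit (cball 0 r) (\<lambda>X q. \<Sum>n\<in>X. ?h n q) theta_phi
        (finite_subsets_at_top UNIV)"
      by (simp add: theta_phi_def [abs_def] theta_f_def)
    show "\<forall>\<^sub>F X in finite_subsets_at_top UNIV. continuous_on (cball 0 r) (\<lambda>q. \<Sum>n\<in>X. ?h n q) \<and>
        (\<lambda>q. \<Sum>n\<in>X. ?h n q) holomorphic_on ball 0 r"
      by (intro always_eventually allI conjI continuous_intros holomorphic_intros)
  qed auto
  have "theta_phi field_differentiable at q" if "norm q < 1" for q
  proof -
    obtain r where "norm q < r" "r < 1"
      using \<open>norm q < 1\<close> dense by blast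
    then show ?thesis
      using *[of r] by (intro holomorphic_on_imp_differentiable_at[of _ "ball 0 r"])
        (auto intro: le_less_trans[OF norm_ge_zero])
  qed
  then show ?thesis
    by (simp add: holomorphic_on_open field_differentiable_def)
qed

section \<open>Theta series in exponential form\<close>

text \<open>Jacobi's theta series with nome \<open>exp a\<close>. With the parameters in the
  exponent, square roots and signs of \<open>r\<close> and \<open>s\<close> become additive
  shifts.\<close>

definition theta_sum :: "complex \<Rightarrow> complex \<Rightarrow> complex" where
  "theta_sum a b = (\<Sum>\<^sub>\<infinity>n\<in>(UNIV :: int set). exp (a * of_int n ^ 2 + b * of_int n))"

lemma abs_summable_theta_sum:
  assumes "Re a < 0"
  shows "(\<lambda>n::int. norm (exp (a * of_int n ^ 2 + b * of_int n))) summable_on UNIV"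
proof -
  \<comment> \<open>The maximum of \<open>Re a * x ^ 2 + (\<bar>Re b\<bar> + 1) * x\<close>, by
    completing the square.\<close>
  define C where "C = (\<bar>Re b\<bar> + 1) ^ 2 / (4 * - Re a)"
  have "norm (exp (a * of_int n ^ 2 + b * of_int n)) \<le> exp C * exp (-1) ^ nat \<bar>n\<bar>" for n :: int
  proof -
    define x where "x = \<bar>real_of_int n\<bar>"
    have "0 \<le> (2 * - Re a * x - (\<bar>Re b\<bar> + 1)) ^ 2 / (4 * - Re a)"
      using assms by (intro divide_nonneg_pos) auto
    also have "\<dots> = - Re a * x ^ 2 - (\<bar>Re b\<bar> + 1) * x + C"
      using assms unfolding C_def by (simp add: field_simps power2_eq_square)
    finally have "Re a * x ^ 2 + \<bar>Re b\<bar> * x \<le> C - x"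
      by (simp add: algebra_simps)
    moreover have "Re b * of_int n \<le> \<bar>Re b\<bar> * x"
      unfolding x_def abs_mult[symmetric] by (rule abs_ge_self)
    moreover have "Re (a * of_int n ^ 2 + b * of_int n) = Re a * x ^ 2 + Re b * of_int n"
      by (simp add: x_def flip: of_int_power)
    ultimately have "Re (a * of_int n ^ 2 + b * of_int n) \<le> C - x"
      by linarith
    then have "norm (exp (a * of_int n ^ 2 + b * of_int n)) \<le> exp (C + real (nat \<bar>n\<bar>) * (-1))"
      by (simp add: x_def)
    also have "\<dots> = exp C * exp (-1) ^ nat \<bar>n\<bar>"
      unfolding exp_add exp_of_nat_mult ..
    finally show ?thesis .
  qed
  then show ?thesis
    by (intro Infinite_Sum.abs_summable_on_comparison_test'[OF summable_on_cmult_right[OF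
          summable_on_geometric_int[of "exp (-1)"], of "exp C"]]) auto
qed

lemma theta_f_exp: "theta_f (exp A) (exp B) = theta_sum ((A + B) / 2) ((A - B) / 2)"
  unfolding theta_f_def theta_sum_def
proof (rule infsum_cong)
  fix n :: int
  have nn: "0 \<le> n * (n + 1)" "0 \<le> n * (n - 1)"
    by (cases "n \<ge> 0"; cases "n \<ge> 1"; auto simp: zero_le_mult_iff)+
  have div2: "complex_of_int (n * (n + 1) div 2) = of_int n * (of_int n + 1) / 2"
       "complex_of_int (n * (n - 1) div 2) = of_int n * (of_int n - 1) / 2"
    by (cases "even n"; auto elim!: evenE oddE simp: algebra_simps)+
  have pow: "exp z ^ nat k = exp (z * of_int k)" if "0 \<le> k" for z :: complex and k
    using that by (simp add: mult.commute flip: exp_of_nat_mult)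
  have "exp A ^ nat (n * (n + 1) div 2) * exp B ^ nat (n * (n - 1) div 2) =
      exp (A * of_int (n * (n + 1) div 2) + B * of_int (n * (n - 1) div 2))"
    using nn by (simp add: pow exp_add)
  also have "\<dots> = exp (A * (of_int n * (of_int n + 1) / 2) + B * (of_int n * (of_int n - 1) / 2))"
    by (simp only: div2)
  also have "A * (of_int n * (of_int n + 1) / 2) + B * (of_int n * (of_int n - 1) / 2) =
      (A + B) / 2 * of_int n ^ 2 + (A - B) / 2 * of_int n"
    by (simp add: field_simps power2_eq_square)
  finally show "exp A ^ nat (n * (n + 1) div 2) * exp B ^ nat (n * (n - 1) div 2) =
      exp ((A + B) / 2 * of_int n ^ 2 + (A - B) / 2 * of_int n)" .
qed

lemma theta_f_neg_exp:
  "theta_f (- exp A) (- exp B) = theta_sum ((A + B) / 2) ((A - B) / 2 + \<i> * pi)"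
proof -
  \<comment> \<open>Opposite shifts keep \<open>A + B\<close> and move \<open>(A - B) / 2\<close> by
    \<open>\<i> * pi\<close>.\<close>
  have "- exp A = exp (A + \<i> * pi)" "- exp B = exp (B - \<i> * pi)"
    by (simp_all add: exp_add exp_diff)
  then show ?thesis
    using theta_f_exp[of "A + \<i> * pi" "B - \<i> * pi"] by (simp add: field_simps)
qed

lemma theta_sum_minus: "theta_sum a (- b) = theta_sum a b"
  unfolding theta_sum_def by (rule infsum_reindex_bij_witness[of _ uminus uminus]) auto

lemma theta_sum_period: "theta_sum a (b + 2 * of_real pi * \<i>) = theta_sum a b"
proof -
  have "exp (a * of_int n ^ 2 + (b + 2 * of_real pi * \<i>) * of_int n) =
      exp (a * of_int n ^ 2 + b * of_int n)" for n :: int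
    using exp_integer_2pi[of "of_int n"] by (simp add: algebra_simps exp_add)
  then show ?thesis
    by (simp add: theta_sum_def)
qed

text \<open>Quasi-periodicity, from the reindexing of \<open>n\<close> by one.\<close>

lemma theta_sum_shift: "theta_sum a (b + 2 * a) = exp (- a - b) * theta_sum a b"
proof -
  have "theta_sum a (b + 2 * a) =
      (\<Sum>\<^sub>\<infinity>n\<in>UNIV. exp (- a - b) * exp (a * of_int n ^ 2 + b * of_int n))"
    unfolding theta_sum_def
    by (rule infsum_reindex_bij_witness[of _ "\<lambda>n. n - 1" "\<lambda>n. n + 1"])
       (auto simp: power2_eq_square algebra_simps simp flip: exp_add)
  then show ?thesis
    by (simp add: theta_sum_def infsum_cmult_right')
qed

text \<open>The classical zero: quasi-periodicity, period and evenness make the value its own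
  negative.\<close>

lemma theta_sum_vanish: "theta_sum a (a + \<i> * pi) = 0"
proof -
  have "theta_sum a (a + \<i> * pi) = theta_sum a ((- a + \<i> * pi) + 2 * a)"
    by (simp add: algebra_simps)
  also have "\<dots> = - theta_sum a (- a + \<i> * pi)"
    by (subst theta_sum_shift) (simp add: exp_minus)
  also have "theta_sum a (- a + \<i> * pi) = theta_sum a (- (a + \<i> * pi) + 2 * of_real pi * \<i>)"
    by (simp add: algebra_simps)
  also have "\<dots> = theta_sum a (a + \<i> * pi)"
    by (simp only: theta_sum_period theta_sum_minus)
  finally show ?thesis
    by simp
qed

text \<open>Splits by the parity of \<open>n\<close>; with \<open>q = exp a\<close> and
  \<open>b = 0\<close> this is \<phi>(q) = \<phi>(q^4) + 2 q \<psi>(q^8).\<close>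

lemma theta_sum_dissect:
  assumes "Re a < 0"
  shows "theta_sum a b = theta_sum (4 * a) (2 * b) + exp (a + b) * theta_sum (4 * a) (4 * a + 2 * b)"
proof -
  let ?h = "\<lambda>n::int. exp (a * of_int n ^ 2 + b * of_int n)"
  have sm: "?h summable_on A" for A
    by (rule summable_on_subset_banach[OF abs_summable_summable[OF abs_summable_theta_sum[OF assms]]]) simp
  have "range (\<lambda>n. 2 * n) \<union> range (\<lambda>n. 2 * n + 1) = (UNIV :: int set)"
    by (auto simp: image_iff) presburger
  then have "theta_sum a b = infsum ?h (range (\<lambda>n. 2 * n) \<union> range (\<lambda>n. 2 * n + 1))"
    by (simp add: theta_sum_def)
  also have "\<dots> = infsum ?h (range (\<lambda>n. 2 * n)) + infsum ?h (range (\<lambda>n. 2 * n + 1))"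
    by (rule infsum_Un_disjoint[OF sm sm]) (auto, presburger)
  also have "infsum ?h (range (\<lambda>n. 2 * n)) = theta_sum (4 * a) (2 * b)"
    unfolding theta_sum_def
    by (subst infsum_reindex) (auto simp: inj_on_def o_def algebra_simps)
  also have "infsum ?h (range (\<lambda>n. 2 * n + 1)) =
      (\<Sum>\<^sub>\<infinity>n\<in>UNIV. exp (a + b) * exp (4 * a * of_int n ^ 2 + (4 * a + 2 * b) * of_int n))"
    by (subst infsum_reindex)
       (auto simp: inj_on_def o_def algebra_simps power2_eq_square simp flip: exp_add intro!: infsum_cong)
  finally show ?thesis
    by (simp add: theta_sum_def infsum_cmult_right')
qed

section \<open>Products of two theta series over cosets of a sublattice\<close>

lemma theta_sum_mult_has_sum:
  assumes "Re a < 0"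
  shows "((\<lambda>(m, n). exp (a * of_int m ^ 2 + b * of_int m + (a * of_int n ^ 2 + c * of_int n)))
    has_sum theta_sum a b * theta_sum a c) (UNIV :: (int \<times> int) set)"
proof -
  let ?f = "\<lambda>b n. exp (a * of_int n ^ 2 + b * of_int n)"
  let ?h = "\<lambda>(m::int, n::int). ?f b m * ?f c n"
  have "(\<lambda>p. norm (?h p)) summable_on UNIV \<times> UNIV"
    using abs_summable_theta_sum[OF assms(1)]
    by (subst Infinite_Sum.abs_summable_on_Sigma_iff)
       (auto simp: norm_mult infsum_cmult_right' abs_mult
         intro!: summable_on_cmult_right summable_on_cmult_left)
  then have sm: "?h summable_on UNIV \<times> UNIV"
    by (rule abs_summable_summable)
  moreover have "infsum ?h (UNIV \<times> UNIV) = theta_sum a b * theta_sum a c"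
    unfolding theta_sum_def
    by (subst infsum_Sigma_banach[OF sm, symmetric]) (simp add: infsum_cmult_left' infsum_cmult_right')
  ultimately show ?thesis
    by (simp add: exp_add has_sum_iff)
qed

text \<open>A product of two theta series runs over \<open>\<int>\<^sup>2\<close>; cut into the \<open>k\<close> cosets of a sublattice on
  which the quadratic form stays diagonal, it becomes a sum of \<open>k\<close> such products.\<close>

lemma theta_sum_mult_cosets:
  fixes k :: int and U V :: "int \<Rightarrow> int \<Rightarrow> int \<Rightarrow> int"
  assumes "Re a < 0" "Re a' < 0"
    and bij: "bij_betw (\<lambda>(r, i, j). (U r i j, V r i j)) ({0..<k} \<times> UNIV) UNIV"
    and diag: "\<And>r i j. a * of_int (U r i j) ^ 2 + b * of_int (U r i j) +
        (a * of_int (V r i j) ^ 2 + c * of_int (V r i j)) =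
        e r + (a' * of_int i ^ 2 + b' r * of_int i + (a' * of_int j ^ 2 + c' r * of_int j))"
  shows "theta_sum a b * theta_sum a c =
    (\<Sum>r\<in>{0..<k}. exp (e r) * (theta_sum a' (b' r) * theta_sum a' (c' r)))"
proof -
  let ?h = "\<lambda>(m, n). exp (a * of_int m ^ 2 + b * of_int m + (a * of_int n ^ 2 + c * of_int n))"
  let ?F = "\<lambda>(r, i, j). (U r i j, V r i j)"
  note hs = theta_sum_mult_has_sum[OF assms(1), of b c]
  have "theta_sum a b * theta_sum a c = infsum ?h UNIV"
    using hs by (simp add: has_sum_iff)
  also have "\<dots> = infsum (\<lambda>p. ?h (?F p)) ({0..<k} \<times> UNIV)"
    using infsum_reindex_bij_betw[OF bij, of ?h] by simp
  also have "\<dots> = (\<Sum>\<^sub>\<infinity>r\<in>{0..<k}. \<Sum>\<^sub>\<infinity>p\<in>UNIV. ?h (?F (r, p)))"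
    using summable_on_reindex_bij_betw[OF bij, of ?h] has_sum_imp_summable[OF hs]
    by (intro infsum_Sigma_banach[symmetric]) simp
  also have "\<dots> = (\<Sum>r\<in>{0..<k}. \<Sum>\<^sub>\<infinity>p\<in>UNIV. ?h (?F (r, p)))"
    by simp
  also have "\<dots> = (\<Sum>r\<in>{0..<k}. exp (e r) * (theta_sum a' (b' r) * theta_sum a' (c' r)))"
  proof (rule sum.cong[OF refl])
    fix r
    have "(\<Sum>\<^sub>\<infinity>p\<in>UNIV. ?h (?F (r, p))) = (\<Sum>\<^sub>\<infinity>(i, j)\<in>UNIV. exp (e r) *
        exp (a' * of_int i ^ 2 + b' r * of_int i + (a' * of_int j ^ 2 + c' r * of_int j)))"
      by (rule infsum_cong) (auto simp: diag simp flip: exp_add)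
    also have "\<dots> = exp (e r) * (theta_sum a' (b' r) * theta_sum a' (c' r))"
      using has_sum_cmult_right[OF theta_sum_mult_has_sum[OF assms(2), of "b' r" "c' r"], of "exp (e r)"]
      by (simp add: has_sum_iff case_prod_unfold)
    finally show "(\<Sum>\<^sub>\<infinity>p\<in>UNIV. ?h (?F (r, p))) =
        exp (e r) * (theta_sum a' (b' r) * theta_sum a' (c' r))" .
  qed
  finally show ?thesis .
qed

lemma theta_sum_mult:
  assumes "Re a < 0"
  shows "theta_sum a b * theta_sum a c =
    theta_sum (2 * a) (b + c) * theta_sum (2 * a) (b - c) +
    exp (a + b) * theta_sum (2 * a) (2 * a + b + c) * theta_sum (2 * a) (2 * a + b - c)"
proof -
  \<comment> \<open>With \<open>m = i + j + r\<close> and \<open>n = i - j\<close>,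
    \<open>m + n = 2 * i + r\<close> determines the coset.\<close>
  have bij: "bij_betw (\<lambda>(r, i, j). (i + j + r, i - j)) ({0..<2} \<times> UNIV) (UNIV :: (int \<times> int) set)"
    by (rule bij_betw_byWitness[where f' = "\<lambda>(m, n). ((m + n) mod 2, (m + n) div 2, (m + n) div 2 - n)"])
       (auto, presburger+)
  have "theta_sum a b * theta_sum a c =
    (\<Sum>r\<in>{0..<2::int}. exp (a * of_int r ^ 2 + b * of_int r) *
       (theta_sum (2 * a) (2 * a * of_int r + b + c) * theta_sum (2 * a) (2 * a * of_int r + b - c)))"
    by (rule theta_sum_mult_cosets[OF assms _ bij]) (use assms in \<open>simp_all add: algebra_simps power2_eq_square\<close>)
  moreover have "{0..<2::int} = {0, 1}"
    by auto
  ultimately show ?thesis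
    by simp
qed

lemma theta_sum_sq_quintic:
  assumes "Re a < 0"
  shows "theta_sum a 0 ^ 2 = theta_sum (5 * a) 0 ^ 2 +
    4 * exp a * theta_sum (5 * a) (4 * a) * theta_sum (5 * a) (2 * a)"
proof -
  \<comment> \<open>The form stays diagonal because
    \<open>(2 * i + j) ^ 2 + (2 * j - i) ^ 2 = 5 * (i ^ 2 + j ^ 2)\<close>, and
    \<open>m + 2 * n = 5 * j + r\<close> determines the coset.\<close>
  have bij: "bij_betw (\<lambda>(r, i, j). (2 * i + j + r, 2 * j - i)) ({0..<5} \<times> UNIV) (UNIV :: (int \<times> int) set)"
    by (rule bij_betw_byWitness[where
          f' = "\<lambda>(m, n). ((m + 2 * n) mod 5, 2 * ((m + 2 * n) div 5) - n, (m + 2 * n) div 5)"])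
       (auto, presburger+)
  have "theta_sum a 0 * theta_sum a 0 =
    (\<Sum>r\<in>{0..<5::int}. exp (a * of_int r ^ 2) *
       (theta_sum (5 * a) (4 * a * of_int r) * theta_sum (5 * a) (2 * a * of_int r)))"
    by (rule theta_sum_mult_cosets[OF assms _ bij]) (use assms in \<open>simp_all add: algebra_simps power2_eq_square\<close>)
  moreover have "{0..<5::int} = {0, 1, 2, 3, 4}"
    by auto
  ultimately have "theta_sum a 0 ^ 2 = theta_sum (5 * a) 0 ^ 2 +
      exp a * theta_sum (5 * a) (4 * a) * theta_sum (5 * a) (2 * a) +
      exp (4 * a) * theta_sum (5 * a) (8 * a) * theta_sum (5 * a) (4 * a) +
      exp (9 * a) * theta_sum (5 * a) (12 * a) * theta_sum (5 * a) (6 * a) +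
      exp (16 * a) * theta_sum (5 * a) (16 * a) * theta_sum (5 * a) (8 * a)"
    by (simp add: power2_eq_square mult.commute algebra_simps)
  \<comment> \<open>Quasi-periodicity reduces the cosets \<open>r = 2, 3, 4\<close> to
    \<open>r = 1\<close>; each prefactor collapses to \<open>exp a\<close>, hence the coefficient
    4.\<close>
  moreover have "theta_sum (5 * a) (6 * a) = exp (- a) * theta_sum (5 * a) (4 * a)"
    "theta_sum (5 * a) (8 * a) = exp (- (3 * a)) * theta_sum (5 * a) (2 * a)"
    "theta_sum (5 * a) (12 * a) = exp (- (7 * a)) * theta_sum (5 * a) (2 * a)"
    "theta_sum (5 * a) (16 * a) = exp (- (11 * a)) * theta_sum (5 * a) (6 * a)"
    using theta_sum_shift[of "5 * a" "- 4 * a"] theta_sum_shift[of "5 * a" "- 2 * a"]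
      theta_sum_shift[of "5 * a" "2 * a"] theta_sum_shift[of "5 * a" "6 * a"]
    by (simp_all add: theta_sum_minus)
  moreover have "exp (4 * a) * exp (- (3 * a)) = exp a"
    "exp (9 * a) * (exp (- (7 * a)) * exp (- a)) = exp a"
    "exp (16 * a) * (exp (- (11 * a)) * (exp (- a) * exp (- (3 * a)))) = exp a"
    by (simp_all flip: exp_add)
  ultimately show ?thesis
    by algebra
qed

section \<open>Product identities for f, \<phi> and \<psi>\<close>

text \<open>In the index-2 splitting the odd coset contains the factor of
  \<open>theta_sum_vanish\<close>, so only the even coset survives.\<close>

lemma theta_f_mult_neg:
  assumes "r \<noteq> 0" "s \<noteq> 0" "norm r < 1" "norm s < 1"
  shows "theta_f r s * theta_f (- r) (- s) = theta_f (- (r ^ 2)) (- (s ^ 2)) * theta_phi (- (r * s))"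
proof -
  define a b where "a = (Ln r + Ln s) / 2" and "b = (Ln r - Ln s) / 2"
  have "a + b = Ln r" "a - b = Ln s"
    by (simp_all add: a_def b_def field_simps)
  then have rs: "r = exp (a + b)" "s = exp (a - b)"
    using assms by simp_all
  have "Re a < 0"
    using assms by (simp add: a_def Re_Ln add_neg_neg)
  from theta_sum_mult[OF this, of b "b + \<i> * pi"]
  have "theta_f r s * theta_f (- r) (- s) =
      theta_sum (2 * a) (2 * b + \<i> * pi) * theta_sum (2 * a) (- (\<i> * pi)) +
      exp (a + b) * theta_sum (2 * a) (2 * a + 2 * b + \<i> * pi) *
        theta_sum (2 * a) (2 * a - \<i> * pi)"
    unfolding rs theta_f_exp theta_f_neg_exp by (simp add: algebra_simps)
  also have "theta_sum (2 * a) (2 * a - \<i> * pi) = theta_sum (2 * a) (2 * a + \<i> * pi)"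
    using theta_sum_period[of "2 * a" "2 * a - \<i> * pi"] by (simp add: algebra_simps)
  also have "\<dots> = 0"
    by (rule theta_sum_vanish)
  finally show ?thesis
    using theta_f_neg_exp[of "2 * (a + b)" "2 * (a - b)"] theta_f_neg_exp[of "2 * a" "2 * a"]
    by (simp add: rs theta_phi_def theta_sum_minus flip: exp_double exp_add)
qed

text \<open>The odd cosets of the two squares have opposite signs and cancel.\<close>

lemma theta_phi_sq_add_sq:
  assumes "q \<noteq> 0" "norm q < 1"
  shows "theta_phi q ^ 2 + theta_phi (- q) ^ 2 = 2 * theta_phi (q ^ 2) ^ 2"
proof -
  define A where "A = Ln q"
  have A: "q = exp A" "Re A < 0"
    using assms by (auto simp: A_def Re_Ln)
  have "theta_sum (2 * A) (2 * A + \<i> * pi + \<i> * pi) = theta_sum (2 * A) (2 * A)"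
    "theta_sum (2 * A) (\<i> * pi + \<i> * pi) = theta_sum (2 * A) 0"
    using theta_sum_period[of "2 * A" "2 * A"] theta_sum_period[of "2 * A" 0]
    by (simp_all add: algebra_simps)
  with theta_sum_mult[OF A(2), of 0 0] theta_sum_mult[OF A(2), of "\<i> * pi" "\<i> * pi"]
  have "theta_sum A 0 ^ 2 + theta_sum A (\<i> * pi) ^ 2 = 2 * theta_sum (2 * A) 0 ^ 2"
    by (simp add: power2_eq_square exp_add)
  then show ?thesis
    using theta_f_exp[of A A] theta_f_neg_exp[of A A] theta_f_exp[of "2 * A" "2 * A"]
    by (simp add: A theta_phi_def flip: exp_double)
qed

text \<open>Both cosets of the square share the factor \<open>theta_psi (q ^ 2)\<close>; the
  cofactor is the parity dissection of \<open>theta_phi q\<close>.\<close>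

lemma theta_psi_sq:
  assumes "q \<noteq> 0" "norm q < 1"
  shows "theta_psi q ^ 2 = theta_phi q * theta_psi (q ^ 2)"
proof -
  define A where "A = Ln q"
  have A: "q = exp A" "Re A < 0"
    using assms by (auto simp: A_def Re_Ln)
  have "theta_sum A 0 = theta_sum (4 * A) 0 + exp A * theta_sum (4 * A) (4 * A)"
    using theta_sum_dissect[OF A(2), of 0] by simp
  moreover have "theta_sum (2 * A) (- A) ^ 2 = theta_sum (4 * A) (2 * A) *
      (theta_sum (4 * A) 0 + exp A * theta_sum (4 * A) (4 * A))"
    using theta_sum_mult[of "2 * A" "- A" "- A"] A(2) theta_sum_minus[of "4 * A" "2 * A"]
    by (simp add: power2_eq_square algebra_simps)
  ultimately show ?thesis
    using theta_f_exp[of A A] theta_f_exp[of A "3 * A"] theta_f_exp[of "2 * A" "6 * A"]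
      theta_sum_minus[of "4 * A" "2 * A"]
    by (simp add: A theta_phi_def theta_psi_def flip: exp_of_nat_mult exp_double)
qed

text \<open>The function called D in the opening outline.\<close>

definition theta_pair :: "complex \<Rightarrow> complex" where
  "theta_pair q = theta_f q (q ^ 9) * theta_f (q ^ 3) (q ^ 7)"

lemma theta_pair_exp: "theta_pair (exp A) = theta_sum (5 * A) (4 * A) * theta_sum (5 * A) (2 * A)"
  using theta_f_exp[of A "9 * A"] theta_f_exp[of "3 * A" "7 * A"]
    theta_sum_minus[of "5 * A" "4 * A"] theta_sum_minus[of "5 * A" "2 * A"]
  by (simp add: theta_pair_def flip: exp_of_nat_mult)

lemma theta_phi_sq_diff:
  assumes "q \<noteq> 0" "norm q < 1"
  shows "theta_phi q ^ 2 - theta_phi (q ^ 5) ^ 2 = 4 * q * theta_pair q"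
proof -
  define A where "A = Ln q"
  have A: "q = exp A" "Re A < 0"
    using assms by (auto simp: A_def Re_Ln)
  show ?thesis
    using theta_sum_sq_quintic[OF A(2)] theta_f_exp[of A A] theta_f_exp[of "5 * A" "5 * A"]
    unfolding A(1) theta_pair_exp by (simp add: theta_phi_def flip: exp_of_nat_mult)
qed

text \<open>The two products have equal even cosets and opposite odd cosets; the odd part is q
  D(-q^2).\<close>

lemma theta_f_cross_diff:
  assumes "q \<noteq> 0" "norm q < 1"
  shows "theta_f q (q ^ 9) * theta_f (- (q ^ 3)) (- (q ^ 7)) -
    theta_f (- q) (- (q ^ 9)) * theta_f (q ^ 3) (q ^ 7) = 2 * q * theta_pair (- (q ^ 2))"
proof -
  define A where "A = Ln q"
  have A: "q = exp A" "Re A < 0"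
    using assms by (auto simp: A_def Re_Ln)
  define T where "T = theta_sum (10 * A)"
  have sym: "T (b - \<i> * pi) = T (b + \<i> * pi)" "T (- b + \<i> * pi) = T (b + \<i> * pi)" for b
    using theta_sum_period[of "10 * A" "b - \<i> * pi"] theta_sum_minus[of "10 * A" "b - \<i> * pi"]
    by (simp_all add: T_def algebra_simps)
  have "theta_sum (5 * A) (- (4 * A)) * theta_sum (5 * A) (- (2 * A) + \<i> * pi) =
      T (6 * A + \<i> * pi) * T (2 * A + \<i> * pi) + exp A * T (4 * A + \<i> * pi) * T (8 * A + \<i> * pi)"
    using theta_sum_mult[of "5 * A" "- (4 * A)" "- (2 * A) + \<i> * pi"] A(2)
      sym(2)[of "6 * A"] sym(1)[of "- (2 * A)"] sym(2)[of "2 * A"] sym(1)[of "8 * A"]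
    by (simp add: T_def algebra_simps)
  moreover have "theta_sum (5 * A) (- (4 * A) + \<i> * pi) * theta_sum (5 * A) (- (2 * A)) =
      T (6 * A + \<i> * pi) * T (2 * A + \<i> * pi) - exp A * T (4 * A + \<i> * pi) * T (8 * A + \<i> * pi)"
    using theta_sum_mult[of "5 * A" "- (4 * A) + \<i> * pi" "- (2 * A)"] A(2)
      sym(2)[of "6 * A"] sym(2)[of "2 * A"]
    by (simp add: T_def algebra_simps exp_add)
  moreover have "theta_pair (- (q ^ 2)) = T (4 * A + \<i> * pi) * T (8 * A + \<i> * pi)"
  proof -
    have "theta_pair (- (q ^ 2)) = theta_f (- exp (2 * A)) (- exp (18 * A)) * theta_f (- exp (6 * A)) (- exp (14 * A))"
      by (simp add: theta_pair_def A flip: exp_of_nat_mult)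
    then show ?thesis
      using sym(2)[of "8 * A"] sym(2)[of "4 * A"] by (simp add: theta_f_neg_exp T_def)
  qed
  ultimately show ?thesis
    using theta_f_exp[of A "9 * A"] theta_f_neg_exp[of A "9 * A"] theta_f_exp[of "3 * A" "7 * A"]
      theta_f_neg_exp[of "3 * A" "7 * A"]
    by (simp add: A algebra_simps flip: exp_of_nat_mult)
qed

section \<open>Descent to the origin and non-vanishing\<close>

text \<open>Under \<open>(r, s) \<mapsto> (- r\<^sup>2, - s\<^sup>2)\<close> the arguments tend to \<open>0\<close>, where every theta function is close
  to \<open>1\<close>. This map occurs in \<open>theta_f_mult_neg\<close>, so non-vanishing and signs propagate back from a
  neighbourhood of \<open>0\<close>.\<close>

lemma theta_descent:
  fixes P :: "complex \<Rightarrow> complex \<Rightarrow> bool"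
  assumes base: "\<And>r s. r \<noteq> 0 \<Longrightarrow> s \<noteq> 0 \<Longrightarrow> norm r < d \<Longrightarrow> norm s < d \<Longrightarrow> P r s"
    and step: "\<And>r s. r \<noteq> 0 \<Longrightarrow> s \<noteq> 0 \<Longrightarrow> norm r < 1 \<Longrightarrow> norm s < 1 \<Longrightarrow>
      P (- (r ^ 2)) (- (s ^ 2)) \<Longrightarrow> P r s"
    and "0 < d" "r \<noteq> 0" "s \<noteq> 0" "norm r < 1" "norm s < 1"
  shows "P r s"
proof -
  have *: "P r s" if "norm r ^ 2 ^ n < d" "norm s ^ 2 ^ n < d" "r \<noteq> 0" "s \<noteq> 0" "norm r < 1" "norm s < 1"
    for r s n
    using that
  proof (induction n arbitrary: r s)
    case 0
    then show ?case
      by (simp add: base)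
  next
    case (Suc n)
    have "P (- (r ^ 2)) (- (s ^ 2))"
      by (rule Suc.IH) (use Suc.prems in \<open>auto simp: norm_power power_less_one_iff simp flip: power_mult\<close>)
    then show ?case
      using Suc.prems step by blast
  qed
  obtain n where n: "max (norm r) (norm s) ^ n < d"
    using real_arch_pow_inv[of d "max (norm r) (norm s)"] assms by auto
  have "t ^ 2 ^ n < d" if "0 \<le> t" "t \<le> max (norm r) (norm s)" for t
  proof -
    have "t ^ 2 ^ n \<le> max (norm r) (norm s) ^ 2 ^ n"
      using that by (intro power_mono) auto
    also have "\<dots> \<le> max (norm r) (norm s) ^ n"
      using assms by (intro power_decreasing) (auto intro: less_imp_le[OF less_exp] simp: le_max_iff_disj)
    finally show ?thesis
      using n by linarith
  qed
  then show ?thesis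
    using assms by (intro *[of r n s]) auto
qed

text \<open>The diagonal case comes first: there the product formula reads \<phi>(q) \<phi>(-q) =
  \<phi>(-q^2)^2 and involves \<phi> alone. The general case then uses it for the factor
  \<open>theta_phi (- (r * s))\<close>.\<close>

lemma theta_phi_nonzero:
  assumes "q \<noteq> 0" "norm q < 1"
  shows "theta_phi q \<noteq> 0"
  using assms(1,1,2,2)
\<comment> \<open>At \<open>t = 1/4\<close> the bound \<open>2 * t / (1 - t)\<close> is 2/3, which
  is below 1.\<close>
proof (rule theta_descent[where P = "\<lambda>r s. theta_phi r \<noteq> 0" and d = "1/4", rotated 3])
  fix r :: complex
  assume "norm r < 1 / 4"
  then have "norm (theta_phi r - 1) \<le> 2 / 3"
    unfolding theta_phi_def using norm_theta_f_minus_one_le[of r "1/4" r] by simp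
  then show "theta_phi r \<noteq> 0"
    by auto
next
  fix r :: complex
  assume "r \<noteq> 0" "norm r < 1" "theta_phi (- (r ^ 2)) \<noteq> 0"
  then show "theta_phi r \<noteq> 0"
    using theta_f_mult_neg[of r r] by (auto simp: theta_phi_def power2_eq_square)
qed auto

lemma theta_f_nonzero:
  assumes "r \<noteq> 0" "s \<noteq> 0" "norm r < 1" "norm s < 1"
  shows "theta_f r s \<noteq> 0"
  using assms
proof (rule theta_descent[where d = "1/4", rotated 3])
  fix r s :: complex
  assume "norm r < 1 / 4" "norm s < 1 / 4"
  then have "norm (theta_f r s - 1) \<le> 2 / 3"
    using norm_theta_f_minus_one_le[of r "1/4" s] by simp
  then show "theta_f r s \<noteq> 0"
    by auto
next
  fix r s :: complex
  assume rs: "r \<noteq> 0" "s \<noteq> 0" "norm r < 1" "norm s < 1" "theta_f (- (r ^ 2)) (- (s ^ 2)) \<noteq> 0"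
  have "norm (r * s) < 1"
    using rs mult_strict_mono[of "norm r" 1 "norm s" 1] by (simp add: norm_mult)
  then show "theta_f r s \<noteq> 0"
    using theta_f_mult_neg[of r s] theta_phi_nonzero[of "- (r * s)"] rs by auto
qed auto

lemma theta_psi_nonzero: "q \<noteq> 0 \<Longrightarrow> norm q < 1 \<Longrightarrow> theta_psi q \<noteq> 0"
  unfolding theta_psi_def by (rule theta_f_nonzero) (auto simp: norm_power power_less_one_iff)

section \<open>Estimates near the origin and the product \<psi>(q) \<psi>(-q)\<close>

lemma norm_mult_minus_one_le:
  fixes a b :: complex
  assumes "norm (a - 1) \<le> x" "norm (b - 1) \<le> y"
  shows "norm (a * b - 1) \<le> x * y + x + y"
proof -
  have "norm (a * b - 1) = norm ((a - 1) * (b - 1) + (a - 1) + (b - 1))"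
    by (simp add: algebra_simps)
  also have "\<dots> \<le> norm (a - 1) * norm (b - 1) + norm (a - 1) + norm (b - 1)"
    by (metis add_mono norm_mult norm_triangle_ineq norm_triangle_le order_refl)
  also have "\<dots> \<le> x * y + x + y"
    using assms order_trans[OF norm_ge_zero assms(1)] by (intro add_mono mult_mono) auto
  finally show ?thesis .
qed

text \<open>The tolerance for the choices of sign and root: 1/20 for theta values keeps their
  quotients within 1/8 of 1.\<close>

lemma theta_f_near_one:
  assumes "norm r < 1 / 50" "norm s < 1 / 50"
  shows "norm (theta_f r s - 1) \<le> 1 / 20"
proof -
  have "norm (theta_f r s - 1) \<le> 2 * (1 / 50) / (1 - 1 / 50)"
    by (rule norm_theta_f_minus_one_le) (use assms in auto)
  then show ?thesis
    by simp
qed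

lemma norm_power_less:
  fixes q :: complex
  assumes "norm q < d" "d \<le> 1" "0 < k"
  shows "norm (q ^ k) < d"
proof -
  have "norm q ^ k \<le> norm q ^ 1"
    using assms by (intro power_decreasing) auto
  then show ?thesis
    using assms by (simp add: norm_power)
qed

text \<open>Near 0 the squares of both sides agree and closeness to 1 fixes the sign. The descent
  step multiplies by \<open>theta_psi (q ^ 2)\<close>, applies the identity at
  \<open>- (q ^ 2)\<close> and cancels.\<close>

lemma theta_psi_mult_neg:
  assumes "q \<noteq> 0" "norm q < 1"
  shows "theta_psi q * theta_psi (- q) = theta_psi (q ^ 2) * theta_phi (- (q ^ 2))"
  using assms(1,1,2,2)
proof (rule theta_descent[where d = "1 / 50" and
      P = "\<lambda>q _. theta_psi q * theta_psi (- q) = theta_psi (q ^ 2) * theta_phi (- (q ^ 2))", rotated 3])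
  fix q :: complex
  assume q: "q \<noteq> 0" "norm q < 1 / 50"
  have near: "norm (theta_psi p - 1) \<le> 1 / 20" "norm (theta_phi p - 1) \<le> 1 / 20"
    if "norm p < 1 / 50" for p
    unfolding theta_psi_def theta_phi_def
    using that by (intro theta_f_near_one norm_power_less; simp)+
  have "norm (theta_psi q * theta_psi (- q) - 1) \<le> 1 / 2"
    by (rule order_trans[OF norm_mult_minus_one_le[OF near(1) near(1)]]) (use q in auto)
  moreover have "norm (theta_psi (q ^ 2) * theta_phi (- (q ^ 2)) - 1) \<le> 1 / 2"
    by (rule order_trans[OF norm_mult_minus_one_le[OF near(1) near(2)]])
       (use norm_power_less[OF q(2), of 2] in auto)
  moreover have "theta_psi q * theta_psi (- q) + theta_psi (q ^ 2) * theta_phi (- (q ^ 2)) \<noteq> 0"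
  proof
    assume "theta_psi q * theta_psi (- q) + theta_psi (q ^ 2) * theta_phi (- (q ^ 2)) = 0"
    then have "(theta_psi q * theta_psi (- q) - 1) + (theta_psi (q ^ 2) * theta_phi (- (q ^ 2)) - 1) = - 2"
      by (simp add: algebra_simps)
    then have "norm ((theta_psi q * theta_psi (- q) - 1) + (theta_psi (q ^ 2) * theta_phi (- (q ^ 2)) - 1)) = 2"
      by simp
    with calculation show False
      using norm_triangle_ineq[of "theta_psi q * theta_psi (- q) - 1" "theta_psi (q ^ 2) * theta_phi (- (q ^ 2)) - 1"]
      by linarith
  qed
  moreover have "(theta_psi q * theta_psi (- q)) ^ 2 = (theta_psi (q ^ 2) * theta_phi (- (q ^ 2))) ^ 2"
    using theta_psi_sq[of q] theta_psi_sq[of "- q"] theta_f_mult_neg[of q q] q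
    by (simp add: power_mult_distrib theta_phi_def) (simp add: power2_eq_square)
  ultimately show "theta_psi q * theta_psi (- q) = theta_psi (q ^ 2) * theta_phi (- (q ^ 2))"
    by (auto simp: power2_eq_iff)
next
  fix q :: complex
  assume q: "q \<noteq> 0" "norm q < 1"
    and "theta_psi (- (q ^ 2)) * theta_psi (- (- (q ^ 2))) =
      theta_psi ((- (q ^ 2)) ^ 2) * theta_phi (- ((- (q ^ 2)) ^ 2))"
  then have IH: "theta_psi (- (q ^ 2)) * theta_psi (q ^ 2) = theta_psi (q ^ 4) * theta_phi (- (q ^ 4))"
    by simp
  note less = norm_power_less[OF q(2)]
  have "theta_psi q * theta_psi (- q) = theta_psi (- (q ^ 2)) * theta_phi (- (q ^ 4))"
    using theta_f_mult_neg[of q "q ^ 3"] q less[of 3]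
    by (simp add: theta_psi_def flip: power_mult power_Suc)
  moreover have "theta_phi (q ^ 2) * theta_phi (- (q ^ 2)) = theta_phi (- (q ^ 4)) ^ 2"
    using theta_f_mult_neg[of "q ^ 2" "q ^ 2"] q less[of 2]
    by (simp add: theta_phi_def power2_eq_square[of "theta_f _ _"] flip: power_mult power_add)
  moreover have "theta_psi (q ^ 2) ^ 2 = theta_phi (q ^ 2) * theta_psi (q ^ 4)"
    using theta_psi_sq[of "q ^ 2"] q less[of 2] by (simp flip: power_mult)
  ultimately have "theta_psi (q ^ 2) * (theta_psi q * theta_psi (- q)) =
      theta_psi (q ^ 2) * (theta_psi (q ^ 2) * theta_phi (- (q ^ 2)))"
    using IH by algebra
  then show "theta_psi q * theta_psi (- q) = theta_psi (q ^ 2) * theta_phi (- (q ^ 2))"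
    using theta_psi_nonzero[of "q ^ 2"] q less[of 2] by simp
qed auto

section \<open>The degree-5 relation between \<phi>(q) and \<phi>(-q)\<close>

text \<open>To be read with \<open>m = \<phi>(q) / \<phi>(q\<^sup>5)\<close>, \<open>k = \<phi>(-q) / \<phi>(-q\<^sup>5)\<close>, \<open>n\<close> and \<open>N\<close> the same quotients for
  \<open>-q\<^sup>2\<close> and \<open>q\<^sup>2\<close>, \<open>y = \<phi>(q\<^sup>5)\<close> and \<open>z = \<phi>(-q\<^sup>5)\<close>. The relation between \<open>m\<close> and \<open>k\<close> makes the
  discriminant of the quadratic equation for \<open>N\<close> the square of \<open>m + k\<close>; closeness to \<open>1\<close> selects the root.\<close>

lemma quintic_algebra:
  fixes m k n N y z :: complex
  assumes n2: "n ^ 2 = m * k"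
    and rel_mk: "(m ^ 2 - 1) * (k ^ 2 - 1) = 4 * (m * k - 1)"
    and rel_Nn: "(N ^ 2 - 1) * (n ^ 2 - 1) = 4 * (N * n - 1)"
    and yz: "y ^ 2 * (m ^ 2 - N ^ 2) = z ^ 2 * (N ^ 2 - k ^ 2)"
    and "n ^ 2 \<noteq> 1" "y \<noteq> 0"
    and near: "norm (m - 1) \<le> 1 / 8" "norm (k - 1) \<le> 1 / 8"
      "norm (n - 1) \<le> 1 / 8" "norm (N - 1) \<le> 1 / 8"
  shows "(m ^ 2 - 1) * n * y ^ 2 = (1 - k ^ 2) * m * z ^ 2"
proof -
  have sqrt_unique: "a = b"
    if "norm (a - 1) \<le> 1 / 8" "norm (b - 1) \<le> 1 / 8" "a ^ 2 = b ^ 2" for a b :: complex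
  proof (rule ccontr)
    assume "a \<noteq> b"
    then have "a = - b"
      using \<open>a ^ 2 = b ^ 2\<close> by (simp add: power2_eq_iff)
    then have "(a - 1) + (b - 1) = - 2"
      by simp
    then have "norm ((a - 1) + (b - 1)) = 2"
      by simp
    with that show False
      using norm_triangle_ineq[of "a - 1" "b - 1"] by linarith
  qed
  have sq: "(n ^ 2 - 1) ^ 2 + 4 = (m + k) ^ 2"
    using n2 rel_mk by algebra
  \<comment> \<open>Multiplied by \<open>n ^ 2 - 1\<close>, \<open>rel_Nn\<close> becomes
    \<open>((n ^ 2 - 1) * N - 2 * n) ^ 2 = (n ^ 2 - 1) ^ 2 + 4\<close>; by \<open>sq\<close> this is
    a difference of squares.\<close>
  have "(N * (1 - n ^ 2) - (m + k - 2 * n)) * (N * (1 - n ^ 2) + (m + k + 2 * n)) = 0"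
    using sq rel_Nn by algebra
  \<comment> \<open>\<open>m + k + 2 * n\<close> is within 1/2 of 4, while the first summand has
    norm below 1/3.\<close>
  moreover have "N * (1 - n ^ 2) + (m + k + 2 * n) \<noteq> 0"
  proof
    assume "N * (1 - n ^ 2) + (m + k + 2 * n) = 0"
    moreover have "norm (n * n - 1) \<le> 1 / 8 * (1 / 8) + 1 / 8 + 1 / 8"
      by (rule norm_mult_minus_one_le) (use near in auto)
    moreover have "norm N \<le> 9 / 8"
      using near(4) norm_triangle_ineq[of "N - 1" 1] by simp
    ultimately have "norm (N * (1 - n ^ 2)) \<le> 9 / 8 * (1 / 8 * (1 / 8) + 1 / 8 + 1 / 8)"
      unfolding norm_mult by (intro mult_mono) (auto simp: power2_eq_square norm_minus_commute)
    moreover define p t where "p = N * (1 - n ^ 2)" and "t = (m - 1) + (k - 1) + (n - 1) + (n - 1)"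
    moreover have "norm t \<le> 1 / 2"
      using near norm_triangle_ineq[of "m - 1" "k - 1"] norm_triangle_ineq[of "(m - 1) + (k - 1)" "n - 1"]
        norm_triangle_ineq[of "(m - 1) + (k - 1) + (n - 1)" "n - 1"]
      unfolding t_def by linarith
    moreover have "p + t = - 4"
      using \<open>N * (1 - n ^ 2) + (m + k + 2 * n) = 0\<close> unfolding p_def t_def by algebra
    then have "norm (p + t) = 4"
      by simp
    ultimately show False
      using norm_triangle_ineq[of p t] by simp
  qed
  ultimately have N: "N * (1 - n ^ 2) = m + k - 2 * n"
    by simp
  have "(1 - n ^ 2) ^ 2 * ((m ^ 2 - 1) * n * (N ^ 2 - k ^ 2) - (1 - k ^ 2) * m * (m ^ 2 - N ^ 2)) = 0"
    using n2 sq N by algebra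
  then have G: "(m ^ 2 - 1) * n * (N ^ 2 - k ^ 2) = (1 - k ^ 2) * m * (m ^ 2 - N ^ 2)"
    using \<open>n ^ 2 \<noteq> 1\<close> by simp
  \<comment> \<open>Allows the final cancellation. Equality would force
    \<open>m = k = n = N\<close>, hence \<open>N * (1 - n ^ 2) = 0\<close>.\<close>
  have "N ^ 2 \<noteq> k ^ 2"
  proof
    assume Nk: "N ^ 2 = k ^ 2"
    then have "m ^ 2 = N ^ 2"
      using yz \<open>y \<noteq> 0\<close> by simp
    then have "m = N" "k = N"
      using Nk near by (simp_all add: sqrt_unique)
    moreover from this have "n = N"
      using n2 near by (simp add: sqrt_unique power2_eq_square)
    ultimately have "m + k - 2 * n = 0"
      by simp
    then have "N * (1 - n ^ 2) = 0"
      unfolding N .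
    then show False
      using near \<open>n ^ 2 \<noteq> 1\<close> by auto
  qed
  moreover have "((m ^ 2 - 1) * n * y ^ 2) * (N ^ 2 - k ^ 2) = ((1 - k ^ 2) * m * z ^ 2) * (N ^ 2 - k ^ 2)"
    using G yz by algebra
  ultimately show ?thesis
    by simp
qed

lemma theta_pair_nonzero: "q \<noteq> 0 \<Longrightarrow> norm q < 1 \<Longrightarrow> theta_pair q \<noteq> 0"
  unfolding theta_pair_def by (auto simp: norm_power power_less_one_iff theta_f_nonzero)

text \<open>Both factors of D have arguments with product \<open>q ^ 10\<close>, so
  \<open>theta_f_mult_neg\<close> yields the same \<phi> factor twice.\<close>

lemma theta_pair_mult_neg:
  assumes "q \<noteq> 0" "norm q < 1"
  shows "theta_pair q * theta_pair (- q) = theta_pair (- (q ^ 2)) * theta_phi (- (q ^ 10)) ^ 2"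
proof -
  note less = norm_power_less[OF assms(2)]
  have "theta_f q (q ^ 9) * theta_f (- q) (- (q ^ 9)) =
      theta_f (- (q ^ 2)) (- (q ^ 18)) * theta_phi (- (q ^ 10))"
    using theta_f_mult_neg[of q "q ^ 9"] assms less[of 9]
    by (simp flip: power_mult power_Suc)
  moreover have "theta_f (q ^ 3) (q ^ 7) * theta_f (- (q ^ 3)) (- (q ^ 7)) =
      theta_f (- (q ^ 6)) (- (q ^ 14)) * theta_phi (- (q ^ 10))"
    using theta_f_mult_neg[of "q ^ 3" "q ^ 7"] assms less[of 3] less[of 7]
    by (simp flip: power_mult power_add)
  moreover have "theta_pair (- q) = theta_f (- q) (- (q ^ 9)) * theta_f (- (q ^ 3)) (- (q ^ 7))"
    "theta_pair (- (q ^ 2)) = theta_f (- (q ^ 2)) (- (q ^ 18)) * theta_f (- (q ^ 6)) (- (q ^ 14))"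
    by (simp_all add: theta_pair_def flip: power_mult)
  ultimately show ?thesis
    unfolding theta_pair_def[of q] by algebra
qed

lemma theta_phi_mult_neg:
  assumes "q \<noteq> 0" "norm q < 1"
  shows "theta_phi q * theta_phi (- q) = theta_phi (- (q ^ 2)) ^ 2"
  using theta_f_mult_neg[of q q] assms
  by (simp add: theta_phi_def power2_eq_square)

text \<open>\<open>theta_phi_sq_diff\<close> at \<open>q\<close>, \<open>- q\<close> and
  \<open>- (q ^ 2)\<close> translates \<open>theta_pair_mult_neg\<close> into this relation.\<close>

lemma theta_phi_quintic:
  assumes "q \<noteq> 0" "norm q < 1"
  shows "(theta_phi q ^ 2 - theta_phi (q ^ 5) ^ 2) * (theta_phi (- q) ^ 2 - theta_phi (- (q ^ 5)) ^ 2) =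
    4 * theta_phi (q ^ 5) * theta_phi (- (q ^ 5)) *
      (theta_phi q * theta_phi (- q) - theta_phi (q ^ 5) * theta_phi (- (q ^ 5)))"
proof -
  note less = norm_power_less[OF assms(2)]
  have "theta_phi (- q) ^ 2 - theta_phi (- (q ^ 5)) ^ 2 = - 4 * q * theta_pair (- q)"
    using theta_phi_sq_diff[of "- q"] assms by simp
  moreover have "theta_phi (- (q ^ 2)) ^ 2 - theta_phi (- (q ^ 10)) ^ 2 = - 4 * q ^ 2 * theta_pair (- (q ^ 2))"
    using theta_phi_sq_diff[of "- (q ^ 2)"] assms less[of 2] by (simp flip: power_mult)
  moreover have "theta_phi (q ^ 5) * theta_phi (- (q ^ 5)) = theta_phi (- (q ^ 10)) ^ 2"
    using theta_phi_mult_neg[of "q ^ 5"] assms less[of 5] by (simp flip: power_mult)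
  ultimately show ?thesis
    using theta_phi_sq_diff[OF assms] theta_phi_mult_neg[OF assms] theta_pair_mult_neg[OF assms]
    by algebra
qed

lemma norm_divide_minus_one_le:
  fixes a b :: complex
  assumes "norm (a - 1) \<le> 1 / 20" "norm (b - 1) \<le> 1 / 20"
  shows "norm (a / b - 1) \<le> 1 / 8"
proof -
  have "19 / 20 \<le> norm b"
    using assms(2) norm_triangle_ineq2[of 1 "1 - b"] by (simp add: norm_minus_commute)
  moreover have "norm (a - b) \<le> 1 / 10"
    using assms norm_triangle_ineq4[of "a - 1" "b - 1"] by simp
  moreover have "a / b - 1 = (a - b) / b"
    using calculation by (auto simp: diff_divide_distrib)
  ultimately show ?thesis
    by (simp add: norm_divide divide_le_eq)
qed

lemma quintic_dehomogenize:
  fixes x y w z :: complex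
  assumes "y \<noteq> 0" "z \<noteq> 0"
    and "(x ^ 2 - y ^ 2) * (w ^ 2 - z ^ 2) = 4 * y * z * (x * w - y * z)"
  shows "((x / y) ^ 2 - 1) * ((w / z) ^ 2 - 1) = 4 * (x / y * (w / z) - 1)"
proof -
  have "((x / y) ^ 2 - 1) * ((w / z) ^ 2 - 1) = (x ^ 2 - y ^ 2) * (w ^ 2 - z ^ 2) / (y ^ 2 * z ^ 2)"
    using assms(1,2) by (simp add: power_divide field_simps)
  also have "\<dots> = 4 * (x / y * (w / z) - 1)"
    using assms(1,2) unfolding assms(3) by (simp add: field_simps power2_eq_square)
  finally show ?thesis .
qed

text \<open>Amounts to D(q) / D(-q) = \<phi>(q) \<phi>(-q^5) / (\<phi>(-q^2) \<phi>(-q^10)), without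
  denominators so that both sides are holomorphic.\<close>

lemma theta_phi_cross_small:
  assumes "q \<noteq> 0" "norm q < 1 / 50"
  shows "(theta_phi q ^ 2 - theta_phi (q ^ 5) ^ 2) * (theta_phi (- (q ^ 2)) * theta_phi (- (q ^ 10))) =
    (theta_phi (- (q ^ 5)) ^ 2 - theta_phi (- q) ^ 2) * (theta_phi q * theta_phi (- (q ^ 5)))"
proof -
  have q1: "norm q < 1"
    using assms by simp
  note less = norm_power_less[OF q1]
  have near: "norm (theta_phi p / theta_phi p' - 1) \<le> 1 / 8"
    if "norm p < 1 / 50" "norm p' < 1 / 50" for p p'
    unfolding theta_phi_def using that by (intro norm_divide_minus_one_le theta_f_near_one)
  note less50 = norm_power_less[OF assms(2)]
  define x y x' y' u v X Y where "x = theta_phi q" "y = theta_phi (q ^ 5)"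
    "x' = theta_phi (- q)" "y' = theta_phi (- (q ^ 5))" "u = theta_phi (- (q ^ 2))"
    "v = theta_phi (- (q ^ 10))" "X = theta_phi (q ^ 2)" "Y = theta_phi (q ^ 10)"
  note defs = this
  have nz: "y \<noteq> 0" "y' \<noteq> 0" "v \<noteq> 0" "Y \<noteq> 0" "x \<noteq> 0"
    unfolding defs using assms(1) q1 less[of 5] less[of 10] by (simp_all add: theta_phi_nonzero)
  have sq: "u ^ 2 = x * x'" "v ^ 2 = y * y'"
    unfolding defs
    using theta_phi_mult_neg[of q] theta_phi_mult_neg[of "q ^ 5"] assms(1) q1 less[of 5]
    by (simp_all flip: power_mult)
  have "(x ^ 2 - y ^ 2) * (x' ^ 2 - y' ^ 2) = 4 * y * y' * (x * x' - y * y')"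
    unfolding defs by (rule theta_phi_quintic[OF assms(1) q1])
  then have rel1: "((x / y) ^ 2 - 1) * ((x' / y') ^ 2 - 1) = 4 * (x / y * (x' / y') - 1)"
    using nz by (intro quintic_dehomogenize)
  have "(X ^ 2 - Y ^ 2) * (u ^ 2 - v ^ 2) = 4 * Y * v * (X * u - Y * v)"
    unfolding defs using theta_phi_quintic[of "q ^ 2"] assms(1) less[of 2] by (simp flip: power_mult)
  then have rel2: "((X / Y) ^ 2 - 1) * ((u / v) ^ 2 - 1) = 4 * (X / Y * (u / v) - 1)"
    using nz by (intro quintic_dehomogenize)
  have "u ^ 2 - v ^ 2 = - 4 * q ^ 2 * theta_pair (- (q ^ 2))"
    unfolding defs using theta_phi_sq_diff[of "- (q ^ 2)"] assms(1) less[of 2] by (simp flip: power_mult)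
  then have "u ^ 2 \<noteq> v ^ 2"
    using theta_pair_nonzero[of "- (q ^ 2)"] assms(1) less[of 2] by auto
  then have n1: "(u / v) ^ 2 \<noteq> 1"
    using nz by (simp add: power_divide)
  have n2: "(u / v) ^ 2 = x / y * (x' / y')"
    by (simp add: power_divide sq)
  \<comment> \<open>Makes \<open>(X / Y) ^ 2\<close> the mean of \<open>(x / y) ^ 2\<close> and
    \<open>(x' / y') ^ 2\<close> with weights \<open>y ^ 2\<close> and
    \<open>y' ^ 2\<close>.\<close>
  have "x ^ 2 + x' ^ 2 = 2 * X ^ 2" "y ^ 2 + y' ^ 2 = 2 * Y ^ 2"
    unfolding defs
    using theta_phi_sq_add_sq[of q] theta_phi_sq_add_sq[of "q ^ 5"] assms(1) q1 less[of 5]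
    by (simp_all flip: power_mult)
  then have "x ^ 2 + x' ^ 2 = (X / Y) ^ 2 * (y ^ 2 + y' ^ 2)"
    using nz by (simp add: power_divide)
  then have yz: "y ^ 2 * ((x / y) ^ 2 - (X / Y) ^ 2) = y' ^ 2 * ((X / Y) ^ 2 - (x' / y') ^ 2)"
    using nz by (simp add: power_divide right_diff_distrib) (simp add: algebra_simps add_divide_distrib)
  have ratios: "norm (x / y - 1) \<le> 1 / 8" "norm (x' / y' - 1) \<le> 1 / 8"
    "norm (u / v - 1) \<le> 1 / 8" "norm (X / Y - 1) \<le> 1 / 8"
    unfolding defs using assms less50[of 2] less50[of 5] less50[of 10] by (intro near; simp)+
  have "((x / y) ^ 2 - 1) * (u / v) * y ^ 2 = (1 - (x' / y') ^ 2) * (x / y) * y' ^ 2"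
    by (rule quintic_algebra[OF n2 rel1 rel2 yz n1 nz(1) ratios])
  moreover have "((x / y) ^ 2 - 1) * y ^ 2 = x ^ 2 - y ^ 2" "(1 - (x' / y') ^ 2) * y' ^ 2 = y' ^ 2 - x' ^ 2"
    using nz by (simp_all add: power_divide left_diff_distrib)
  ultimately have "(x ^ 2 - y ^ 2) * (u / v) = (y' ^ 2 - x' ^ 2) * (x / y)"
    by algebra
  then have "(x ^ 2 - y ^ 2) * u * y = (y' ^ 2 - x' ^ 2) * x * v"
    using nz by (simp add: field_simps)
  then have "((x ^ 2 - y ^ 2) * (u * v)) * y = ((y' ^ 2 - x' ^ 2) * (x * y')) * y"
    using sq(2) by algebra
  then show ?thesis
    using nz unfolding defs by simp
qed

section \<open>Analytic continuation and conclusion\<close>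

lemma theta_phi_cross:
  assumes "norm q < 1"
  shows "(theta_phi q ^ 2 - theta_phi (q ^ 5) ^ 2) * (theta_phi (- (q ^ 2)) * theta_phi (- (q ^ 10))) =
    (theta_phi (- (q ^ 5)) ^ 2 - theta_phi (- q) ^ 2) * (theta_phi q * theta_phi (- (q ^ 5)))"
\<comment> \<open>The small case excludes 0, hence the punctured ball as the open set of
  agreement.\<close>
proof (rule analytic_continuation_open[where s = "ball 0 (1 / 50) - {0}" and s' = "ball 0 1" and z = q])
  have hol: "(\<lambda>q. theta_phi (g q)) holomorphic_on ball 0 1"
    if "g holomorphic_on ball 0 1" "\<And>q. norm q < 1 \<Longrightarrow> norm (g q) < 1" for g
    using holomorphic_on_compose_gen[OF that(1) theta_phi_holomorphic] that(2)
    by (force simp: o_def)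
  show "(\<lambda>q. (theta_phi q ^ 2 - theta_phi (q ^ 5) ^ 2) * (theta_phi (- (q ^ 2)) * theta_phi (- (q ^ 10))))
      holomorphic_on ball 0 1"
    "(\<lambda>q. (theta_phi (- (q ^ 5)) ^ 2 - theta_phi (- q) ^ 2) * (theta_phi q * theta_phi (- (q ^ 5))))
      holomorphic_on ball 0 1"
    by (intro holomorphic_intros hol; simp add: norm_power power_less_one_iff)+
  show "ball 0 (1 / 50) - {0} \<noteq> ({} :: complex set)"
    using perfect_choose_dist[of "1 / 50" "0 :: complex"] by (auto simp: dist_commute)
qed (use assms theta_phi_cross_small in auto)

text \<open>Insert \<phi>(q) = \<psi>(q)^2 / \<psi>(q^2) and \<phi>(-q^2) = \<psi>(q) \<psi>(-q) /
  \<psi>(q^2), with their analogues at -q^5 and q^5, into \<open>theta_phi_cross\<close>.\<close>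

lemma theta_pair_quotient:
  assumes "q \<noteq> 0" "norm q < 1"
  shows "theta_pair q / theta_pair (- q) = theta_psi q * theta_psi (- (q ^ 5)) / (theta_psi (- q) * theta_psi (q ^ 5))"
proof -
  note less = norm_power_less[OF assms(2)]
  have nz: "theta_psi q \<noteq> 0" "theta_psi (- q) \<noteq> 0" "theta_psi (q ^ 5) \<noteq> 0"
    "theta_psi (- (q ^ 5)) \<noteq> 0" "theta_pair (- q) \<noteq> 0"
    using assms less[of 5] by (simp_all add: theta_psi_nonzero theta_pair_nonzero)
  have "q * (theta_pair q * (theta_phi (- (q ^ 2)) * theta_phi (- (q ^ 10)))) =
      q * (theta_pair (- q) * (theta_phi q * theta_phi (- (q ^ 5))))"
    using theta_phi_cross[OF assms(2)] theta_phi_sq_diff[OF assms] theta_phi_sq_diff[of "- q"] assms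
    by simp algebra
  then have "theta_pair q * (theta_phi (- (q ^ 2)) * theta_phi (- (q ^ 10))) =
      theta_pair (- q) * (theta_phi q * theta_phi (- (q ^ 5)))"
    using assms by simp
  moreover have "theta_psi q ^ 2 = theta_phi q * theta_psi (q ^ 2)"
    by (rule theta_psi_sq[OF assms])
  moreover have "theta_psi (- (q ^ 5)) ^ 2 = theta_phi (- (q ^ 5)) * theta_psi (q ^ 10)"
    using theta_psi_sq[of "- (q ^ 5)"] assms less[of 5] by (simp flip: power_mult)
  moreover have "theta_psi (q ^ 5) * theta_psi (- (q ^ 5)) = theta_psi (q ^ 10) * theta_phi (- (q ^ 10))"
    using theta_psi_mult_neg[of "q ^ 5"] assms less[of 5] by (simp flip: power_mult)
  ultimately have "(theta_psi q * theta_psi (- (q ^ 5))) * (theta_pair q * (theta_psi (- q) * theta_psi (q ^ 5))) =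
      (theta_psi q * theta_psi (- (q ^ 5))) * (theta_pair (- q) * (theta_psi q * theta_psi (- (q ^ 5))))"
    using theta_psi_mult_neg[OF assms] by algebra
  then show ?thesis
    using nz by (simp add: field_simps)
qed

lemma theta_f_0_0: "theta_f 0 0 = 1"
  using norm_theta_f_minus_one_le[of 0 0 0] by simp

theorem theorem3p2:
  fixes q :: complex
  assumes "norm q < 1"
  shows "Gamma1 q ^ 2 + Gamma2 q ^ 2 =
      theta_phi q ^ 4 / (4 * theta_phi (- (q ^ 10)) ^ 4)
    + theta_phi (q ^ 5) ^ 4 / (4 * theta_phi (- (q ^ 10)) ^ 4)
    - theta_phi q ^ 2 * theta_phi (q ^ 5) ^ 2 / (2 * theta_phi (- (q ^ 10)) ^ 4)
    + 2 * theta_psi q * theta_psi (- (q ^ 5)) / (theta_psi (- q) * theta_psi (q ^ 5))"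
proof (cases "q = 0")
  case True
  \<comment> \<open>Every theta value is 1 here, and both sides equal 2.\<close>
  then show ?thesis
    by (simp add: Gamma1_def Gamma2_def theta_phi_def theta_psi_def theta_f_0_0)
next
  case False
  note less = norm_power_less[OF assms]
  define x y v where "x = theta_phi q" "y = theta_phi (q ^ 5)" "v = theta_phi (- (q ^ 10))"
  define a b a' b' where "a = theta_f q (q ^ 9)" "b = theta_f (q ^ 3) (q ^ 7)"
    "a' = theta_f (- q) (- (q ^ 9))" "b' = theta_f (- (q ^ 3)) (- (q ^ 7))"
  note defs = \<open>x = _\<close> \<open>y = _\<close> \<open>v = _\<close> \<open>a = _\<close> \<open>b = _\<close> \<open>a' = _\<close> \<open>b' = _\<close>
  have D: "theta_pair q = a * b" "theta_pair (- q) = a' * b'"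
    by (simp_all add: theta_pair_def defs)
  have nz: "v \<noteq> 0" "a' \<noteq> 0" "b' \<noteq> 0"
    unfolding defs using False assms less[of 10] less[of 9] less[of 3] less[of 7]
    by (simp_all add: theta_phi_nonzero theta_f_nonzero)
  have "a * b' - a' * b = 2 * q * theta_pair (- (q ^ 2))"
    unfolding defs by (rule theta_f_cross_diff[OF False assms])
  moreover have "a * b * (a' * b') = theta_pair (- (q ^ 2)) * v ^ 2"
    using theta_pair_mult_neg[OF False assms] D by (simp add: defs)
  moreover have "x ^ 2 - y ^ 2 = 4 * q * (a * b)"
    using theta_phi_sq_diff[OF False assms] D by (simp add: defs)
  \<comment> \<open>Eliminates D(-q^2) between the cross difference and the product formula.\<close>
  ultimately have "2 * v ^ 2 * (a * b' - a' * b) = (x ^ 2 - y ^ 2) * (a' * b')"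
    by algebra
  then have diff: "a / a' - b / b' = (x ^ 2 - y ^ 2) / (2 * v ^ 2)"
    using nz by (simp add: field_simps)
  have "(a / a') ^ 2 + (b / b') ^ 2 = (a / a' - b / b') ^ 2 + 2 * (theta_pair q / theta_pair (- q))"
    by (simp add: D power2_diff)
  also have "(a / a' - b / b') ^ 2 = x ^ 4 / (4 * v ^ 4) + y ^ 4 / (4 * v ^ 4) - x ^ 2 * y ^ 2 / (2 * v ^ 4)"
    unfolding diff using nz by (simp add: field_simps power2_eq_square power4_eq_xxxx)
  finally show ?thesis
    unfolding theta_pair_quotient[OF False assms]
    by (simp add: Gamma1_def Gamma2_def defs mult.assoc)
qed

end
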